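(* Let $f\in\mathcal{A}$ be such that $$\frac{z}{f(z)}=1+b_{1}z+b_{2}z^{2}+\cdots\quad (z\in\mathbb{D}),\qquad b_{n}\geq 0\ \text{ for } n=1,2,3,\ldots$$ Then the condition $$\sum_{n=1}^{\infty}(2n-1)b_{n}\leq 1$$ is necessary and sufficient for $f$ to be in the class $\mathcal{S}^{*}(1/2)$.
   Context: Let $\mathbb{D}=\{z\in\mathbb{C}:|z|<1\}$, and let $\mathcal{A}$ be the class of functions $f$ analytic in $\mathbb{D}$ of the form $f(z)=z+a_2z^2+a_3z^3+\cdots$. For $0\le\alpha<1$, the class of starlike functions of order $\alpha$ is $\mathcal{S}^*(\alpha)=\left\{f\in\mathcal{A}:\operatorname{Re}\frac{zf'(z)}{f(z)}>\alpha,\ z\in\mathbb{D}\right\}$. *)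

theory Defs
  imports "HOL-Complex_Analysis.Complex_Analysis"
begin

definition class_A :: "(complex \<Rightarrow> complex) set" where
  "class_A = {f. f holomorphic_on ball 0 1 \<and>
     (\<exists>a. \<forall>z\<in>ball 0 1. (\<lambda>n. a (n + 2) * z ^ (n + 2)) sums (f z - z))}"

lemma class_A_iff:
  "f \<in> class_A \<longleftrightarrow> f holomorphic_on ball 0 1 \<and> f 0 = 0 \<and> deriv f 0 = 1"
proof
  assume "f \<in> class_A"
  then obtain a where hol: "f holomorphic_on ball 0 1"
    and a: "\<And>z. z \<in> ball 0 1 \<Longrightarrow> (\<lambda>n. a (n + 2) * z ^ (n + 2)) sums (f z - z)"
    unfolding class_A_def by blast
  define c where "c n = (if n = 0 then 0 else if n = 1 then 1 else a n)" for n :: nat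
  have c: "(\<lambda>n. c n * z ^ n) sums f z" if "z \<in> ball 0 1" for z
  proof -
    have "(\<lambda>n. c (n + 2) * z ^ (n + 2)) sums (f z - z)"
      using a[OF that] by (simp add: c_def)
    then have "(\<lambda>n. c n * z ^ n) sums (f z - z + (\<Sum>n<2. c n * z ^ n))"
      using sums_iff_shift[of "\<lambda>n. c n * z ^ n" 2 "f z - z"] by simp
    then show ?thesis
      by (simp add: c_def numeral_2_eq_2)
  qed
  have "f 0 = 0"
    using c[of 0] sums_unique2[OF c[of 0] powser_sums_zero[of c]] by (simp add: c_def)
  moreover have "(f has_field_derivative 1) (at 0)"
  proof -
    have "((\<lambda>z. \<Sum>n. c n * z ^ n) has_field_derivative (\<Sum>n. diffs c n * 0 ^ n)) (at 0)"
      by (rule termdiffs_strong[of c "1/2"])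
         (use c[of "1/2"] in \<open>auto simp: sums_iff norm_divide\<close>)
    then have "((\<lambda>z. \<Sum>n. c n * z ^ n) has_field_derivative 1) (at 0)"
      by (simp add: diffs_def c_def)
    then show ?thesis
      by (rule has_field_derivative_transform_within_open[of _ _ _ "ball 0 1"])
         (use c in \<open>auto simp: sums_iff\<close>)
  qed
  ultimately show "f holomorphic_on ball 0 1 \<and> f 0 = 0 \<and> deriv f 0 = 1"
    using hol DERIV_imp_deriv by blast
next
  assume R: "f holomorphic_on ball 0 1 \<and> f 0 = 0 \<and> deriv f 0 = 1"
  define a where "a n = (deriv ^^ n) f 0 / fact n" for n
  have "(\<lambda>n. a (n + 2) * z ^ (n + 2)) sums (f z - z)" if "z \<in> ball 0 1" for z
  proof -
    have "(\<lambda>n. a n * (z - 0) ^ n) sums f z"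
      unfolding a_def using R that by (intro holomorphic_power_series) auto
    then have "(\<lambda>n. a (n + 2) * z ^ (n + 2)) sums (f z - (\<Sum>n<2. a n * z ^ n))"
      using sums_iff_shift'[of "\<lambda>n. a n * z ^ n" 2 "f z"] by simp
    then show ?thesis
      using R by (simp add: a_def numeral_2_eq_2)
  qed
  then show "f \<in> class_A"
    using R unfolding class_A_def by blast
qed

text \<open>At \<open>z = 0\<close> the quotient \<open>z f'(z) / f(z)\<close> has a removable singularity with value
  \<open>1\<close>, which exceeds every \<open>\<alpha> < 1\<close>; there HOL would evaluate it as \<open>0 / 0 = 0\<close>, so the
  condition is imposed on the punctured disc only.\<close>

definition starlike_of_order :: "real \<Rightarrow> (complex \<Rightarrow> complex) set" where
  "starlike_of_order \<alpha> = {f \<in> class_A. \<forall>z\<in>ball 0 1 - {0}.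
     f z \<noteq> 0 \<and> Re (z * deriv f z / f z) > \<alpha>}"

end

theory Submission
  imports Defs
begin

text \<open>Write \<open>g(z) = z / f(z) = 1 + \<Sum> b\<^sub>n z\<^sup>n\<close>. Logarithmic differentiation of \<open>f = z / g\<close> gives
  \<open>z f'(z) / f(z) = 1 - z g'(z) / g(z)\<close> with \<open>z g'(z) = \<Sum> n b\<^sub>n z\<^sup>n\<close>
  (\<open>log_derivative_id_over_power_series\<close>), so membership in the class becomes a statement about
  two power series with nonnegative coefficients.

  The condition is sufficient because \<open>Re p > 1/2\<close> says that \<open>p\<close> is closer to \<open>1\<close> than to \<open>0\<close>. For
  \<open>p = 1 - z g' / g\<close> this is \<open>\<bar>z g'\<bar> < \<bar>g - z g'\<bar>\<close>, where
  \<open>g - z g' = 1 - \<Sum> (n-1) b\<^sub>n z\<^sup>n\<close>. By the triangle inequality it is enough that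
  \<open>\<Sum> n b\<^sub>n \<bar>z\<bar>\<^sup>n < 1 - \<Sum> (n-1) b\<^sub>n \<bar>z\<bar>\<^sup>n\<close>, that is \<open>\<Sum> (2n-1) b\<^sub>n \<bar>z\<bar>\<^sup>n < 1\<close>
  (\<open>coefficient_bound_imp_Re_gt_half\<close>).

  It is necessary because on the segment \<open>0 < r < 1\<close> all quantities are real and \<open>g(r) \<ge> 1\<close>, so
  \<open>1 - r g'(r) / g(r) > 1/2\<close> can be multiplied out to \<open>\<Sum> (2n-1) b\<^sub>n r\<^sup>n < 1\<close>
  (\<open>Re_gt_half_imp_real_series_less_1\<close>); the terms are nonnegative, so the bound passes to the limit \<open>r \<rightarrow> 1\<close> through the partial sums
  (\<open>power_series_bounded_near_1_imp_summable\<close>).\<close>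

lemma Re_gt_half_iff_closer_to_1: "Re p > 1/2 \<longleftrightarrow> norm (p - 1) < norm p"
proof -
  have "norm (p - 1) < norm p \<longleftrightarrow> (norm (p - 1))\<^sup>2 < (norm p)\<^sup>2"
    using abs_le_square_iff[of "norm p" "norm (p - 1)"] by (simp add: not_le[symmetric])
  also have "\<dots> \<longleftrightarrow> Re p > 1/2"
    unfolding cmod_power2 by (simp add: power2_eq_square algebra_simps)
  finally show ?thesis by simp
qed

text \<open>The coefficients are shifted, \<open>a n\<close> belonging to \<open>z\<^sup>n\<^sup>+\<^sup>1\<close>, so that the constant term \<open>1\<close> of
  \<open>z / f(z)\<close> stays apart.\<close>

lemma log_derivative_id_over_power_series:
  fixes f :: "complex \<Rightarrow> complex" and a :: "nat \<Rightarrow> complex"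
  assumes nz: "\<And>z. z \<in> ball 0 1 - {0} \<Longrightarrow> f z \<noteq> 0"
    and ser: "\<And>z. z \<in> ball 0 1 - {0} \<Longrightarrow> (\<lambda>n. a n * z ^ (n + 1)) sums (z / f z - 1)"
    and z: "z \<in> ball 0 1 - {0}"
  obtains W where "(\<lambda>n. of_nat (n + 1) * a n * z ^ (n + 1)) sums W"
    and "z * deriv f z / f z = 1 - W / (z / f z)"
proof -
  define c where "c n = (case n of 0 \<Rightarrow> 1 | Suc m \<Rightarrow> a m)" for n
  define G where "G w = (\<Sum>n. c n * w ^ n)" for w
  have sums_G: "(\<lambda>n. c n * w ^ n) sums (w / f w)" if "w \<in> ball 0 1 - {0}" for w
    using ser[OF that] sums_Suc_iff[of "\<lambda>n. c n * w ^ n" "w / f w - 1"] by (simp add: c_def)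
  have G: "G w = w / f w" if "w \<in> ball 0 1 - {0}" for w
    using sums_G[OF that] by (simp add: G_def sums_iff)
  have summ: "summable (\<lambda>n. c n * w ^ n)" if "norm w < 1" for w
  proof (cases "w = 0")
    case False
    then show ?thesis using sums_G[of w] that by (auto simp: sums_iff)
  qed (auto intro: sums_summable[OF powser_sums_zero])
  define D where "D = (\<Sum>n. diffs c n * z ^ n)"
  have "(\<lambda>n. diffs c n * z ^ n) sums D" and dG: "(G has_field_derivative D) (at z)"
    using termdiff_converges[of z 1 c] termdiffs_strong'[of 1 c z] summ z
    by (auto simp: D_def G_def[abs_def] summable_sums)
  then have "(\<lambda>n. z * (diffs c n * z ^ n)) sums (z * D)"
    by (intro sums_mult)
  then have W: "(\<lambda>n. of_nat (n + 1) * a n * z ^ (n + 1)) sums (z * D)"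
    by (simp add: diffs_def c_def algebra_simps)
  have Gz: "G z \<noteq> 0" using G[OF z] nz[OF z] z by simp
  have "((\<lambda>w. w / G w) has_field_derivative (G z - z * D) / (G z * G z)) (at z)"
    using DERIV_divide[OF DERIV_ident dG Gz] by simp
  then have "(f has_field_derivative (G z - z * D) / (G z * G z)) (at z)"
    by (rule has_field_derivative_transform_within_open[of _ _ _ "ball 0 1 - {0}"])
       (use z G nz in \<open>auto intro: open_delete\<close>)
  then have "deriv f z = (G z - z * D) / (G z * G z)"
    by (rule DERIV_imp_deriv)
  then have "z * deriv f z / f z = G z * ((G z - z * D) / (G z * G z))"
    using G[OF z] by simp
  also have "\<dots> = 1 - (z * D) / G z"
    using Gz by (simp add: field_simps)
  finally have "z * deriv f z / f z = 1 - (z * D) / (z / f z)"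
    by (simp only: G[OF z])
  with W show thesis by (rule that)
qed

lemma coefficient_bound_imp_Re_gt_half:
  fixes a :: "nat \<Rightarrow> real" and z A W :: complex
  assumes a: "\<And>n. a n \<ge> 0"
    and summ: "summable (\<lambda>n. (2 * real (n + 1) - 1) * a n)"
    and le1: "(\<Sum>n. (2 * real (n + 1) - 1) * a n) \<le> 1"
    and A: "(\<lambda>n. of_real (a n) * z ^ (n + 1)) sums A"
    and W: "(\<lambda>n. of_nat (n + 1) * of_real (a n) * z ^ (n + 1)) sums W"
    and z: "norm z < 1" and nz: "1 + A \<noteq> 0"
  shows "Re (1 - W / (1 + A)) > 1/2"
proof -
  define r where "r = norm z"
  have r: "0 \<le> r" "r < 1" using z by (auto simp: r_def)
  define t where "t n = (2 * real (n + 1) - 1) * a n" for n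
  have t0: "t n \<ge> 0" for n using a by (simp add: t_def)
  have summ_t: "summable t" and t_le1: "suminf t \<le> 1"
    using summ le1 by (simp_all add: t_def[abs_def])
  have pow_le: "r ^ (n + 1) \<le> r" for n
    using r power_decreasing[of 1 "n + 1" r] by simp
  have dom: "k * a n * r ^ (n + 1) \<le> t n * r" if "0 \<le> k" "k \<le> 2 * real (n + 1) - 1" for k n
    unfolding t_def using that r a pow_le by (intro mult_mono) auto
  have summ_tr: "summable (\<lambda>n. t n * r)" using summ_t by (rule summable_mult2)
  have s1: "summable (\<lambda>n. real (n + 1) * a n * r ^ (n + 1))"
    by (rule summable_comparison_test'[OF summ_tr, of 0])
       (use dom a r in \<open>auto simp: abs_mult\<close>)
  have s2: "summable (\<lambda>n. real n * a n * r ^ (n + 1))"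
    by (rule summable_comparison_test'[OF summ_tr, of 0])
       (use dom a r in \<open>auto simp: abs_mult\<close>)
  \<comment> \<open>The factor \<open>r\<close> survives from \<open>r\<^sup>n\<^sup>+\<^sup>1 \<le> r\<close>; it makes the estimate strict when the
    coefficient sum equals \<open>1\<close>.\<close>
  have "(\<Sum>n. real (n + 1) * a n * r ^ (n + 1)) + (\<Sum>n. real n * a n * r ^ (n + 1))
      = (\<Sum>n. t n * r ^ (n + 1))"
    by (subst suminf_add[OF s1 s2]) (simp add: t_def algebra_simps)
  also have "\<dots> \<le> (\<Sum>n. t n * r)"
  proof (rule suminf_le[OF _ _ summ_tr])
    show "summable (\<lambda>n. t n * r ^ (n + 1))"
      using summable_add[OF s1 s2] by (simp add: t_def algebra_simps)
  qed (use pow_le t0 in \<open>auto intro: mult_left_mono\<close>)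
  also have "\<dots> = suminf t * r" using suminf_mult2[OF summ_t] by simp
  also have "\<dots> \<le> 1 * r" using t_le1 r by (intro mult_right_mono)
  finally have sum_lt: "(\<Sum>n. real (n + 1) * a n * r ^ (n + 1)) + (\<Sum>n. real n * a n * r ^ (n + 1)) < 1"
    using r by simp
  have nW: "norm W \<le> (\<Sum>n. real (n + 1) * a n * r ^ (n + 1))"
  proof -
    have eq: "norm (of_nat (n + 1) * of_real (a n) * z ^ (n + 1)) = real (n + 1) * a n * r ^ (n + 1)" for n
      using a[of n] by (simp only: norm_mult norm_power norm_of_nat norm_of_real r_def abs_of_nonneg)
    show ?thesis
      using summable_norm[of "\<lambda>n. of_nat (n + 1) * of_real (a n) * z ^ (n + 1)"] s1 sums_unique[OF W]
      unfolding eq by simp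
  qed
  have nV: "norm (W - A) \<le> (\<Sum>n. real n * a n * r ^ (n + 1))"
  proof -
    have V: "(\<lambda>n. of_nat n * of_real (a n) * z ^ (n + 1)) sums (W - A)"
      using sums_diff[OF W A] by (simp add: algebra_simps)
    have eq: "norm (of_nat n * of_real (a n) * z ^ (n + 1)) = real n * a n * r ^ (n + 1)" for n
      using a[of n] by (simp only: norm_mult norm_power norm_of_nat norm_of_real r_def abs_of_nonneg)
    show ?thesis
      using summable_norm[of "\<lambda>n. of_nat n * of_real (a n) * z ^ (n + 1)"] s2 sums_unique[OF V]
      unfolding eq by simp
  qed
  have "1 - norm (W - A) \<le> norm (1 + A - W)"
    using norm_triangle_ineq2[of 1 "W - A"] by (simp add: algebra_simps)
  then have "norm W < norm (1 + A - W)" using nW nV sum_lt by linarith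
  then have "norm W / norm (1 + A) < norm (1 + A - W) / norm (1 + A)"
    using nz by (intro divide_strict_right_mono) auto
  then have "norm (W / (1 + A)) < norm ((1 + A - W) / (1 + A))"
    by (simp only: norm_divide)
  moreover have "(1 + A - W) / (1 + A) = 1 - W / (1 + A)"
    using nz by (simp add: diff_divide_distrib)
  ultimately have "norm ((1 - W / (1 + A)) - 1) < norm (1 - W / (1 + A))"
    by simp
  then show ?thesis
    by (simp only: Re_gt_half_iff_closer_to_1)
qed

lemma Re_gt_half_imp_real_series_less_1:
  fixes a :: "nat \<Rightarrow> real" and r :: real and A W :: complex
  assumes a: "\<And>n. a n \<ge> 0" and r: "0 \<le> r"
    and A: "(\<lambda>n. of_real (a n) * of_real r ^ (n + 1)) sums A"
    and W: "(\<lambda>n. of_nat (n + 1) * of_real (a n) * of_real r ^ (n + 1)) sums W"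
    and half: "Re (1 - W / (1 + A)) > 1/2"
  shows "summable (\<lambda>n. (2 * real (n + 1) - 1) * a n * r ^ (n + 1))"
    and "(\<Sum>n. (2 * real (n + 1) - 1) * a n * r ^ (n + 1)) < 1"
proof -
  have eqA: "of_real (a n) * of_real r ^ (n + 1) = complex_of_real (a n * r ^ (n + 1))" for n
    by simp
  have eqW: "of_nat (n + 1) * of_real (a n) * of_real r ^ (n + 1)
      = complex_of_real (real (n + 1) * a n * r ^ (n + 1))" for n
    by simp
  have A': "(\<lambda>n. a n * r ^ (n + 1)) sums Re A" and "Im A = 0"
    using sums_Re[OF A] sums_Im[OF A] sums_unique2[OF sums_zero] unfolding eqA by auto
  have W': "(\<lambda>n. real (n + 1) * a n * r ^ (n + 1)) sums Re W" and "Im W = 0"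
    using sums_Re[OF W] sums_Im[OF W] sums_unique2[OF sums_zero] unfolding eqW by auto
  have A_real: "A = of_real (Re A)" and W_real: "W = of_real (Re W)"
    using \<open>Im A = 0\<close> \<open>Im W = 0\<close> by (simp_all add: complex_eq_iff)
  have "Re A \<ge> 0"
    using sums_le[OF _ sums_zero A'] a r by simp
  have "W / (1 + A) = of_real (Re W / (1 + Re A))"
    using A_real W_real by (metis of_real_1 of_real_add of_real_divide)
  then have "1 - Re W / (1 + Re A) > 1/2"
    using half by simp
  then have lt: "2 * Re W - Re A < 1"
    using \<open>Re A \<ge> 0\<close> by (simp add: field_simps)
  have "(\<lambda>n. (2 * real (n + 1) - 1) * a n * r ^ (n + 1)) sums (2 * Re W - Re A)"
    using sums_diff[OF sums_mult[OF W', of 2] A'] by (simp add: algebra_simps)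
  with lt show "summable (\<lambda>n. (2 * real (n + 1) - 1) * a n * r ^ (n + 1))"
    "(\<Sum>n. (2 * real (n + 1) - 1) * a n * r ^ (n + 1)) < 1"
    by (auto simp: sums_iff)
qed

text \<open>A one-sided Abel limit: nonnegative terms make every partial sum at \<open>r < 1\<close> a lower bound
  of the full series, and a partial sum is continuous in \<open>r\<close>.\<close>

lemma power_series_bounded_near_1_imp_summable:
  fixes t :: "nat \<Rightarrow> real"
  assumes t: "\<And>n. t n \<ge> 0"
    and summ: "\<And>r. 0 < r \<Longrightarrow> r < 1 \<Longrightarrow> summable (\<lambda>n. t n * r ^ (n + 1))"
    and le: "\<And>r. 0 < r \<Longrightarrow> r < 1 \<Longrightarrow> (\<Sum>n. t n * r ^ (n + 1)) \<le> B"
  shows "summable t" and "suminf t \<le> B"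
proof -
  have partial: "(\<Sum>n<N. t n) \<le> B" for N
  proof (rule tendsto_upperbound)
    have "((\<lambda>r. \<Sum>n<N. t n * r ^ (n + 1)) \<longlongrightarrow> (\<Sum>n<N. t n * 1 ^ (n + 1))) (at_left 1)"
      by (intro tendsto_intros)
    then show "((\<lambda>r. \<Sum>n<N. t n * r ^ (n + 1)) \<longlongrightarrow> (\<Sum>n<N. t n)) (at_left 1)"
      by simp
    have "(\<Sum>n<N. t n * r ^ (n + 1)) \<le> B" if "0 < r" "r < 1" for r
      using sum_le_suminf[OF summ[OF that], of "{..<N}"] le[OF that] t that by force
    then show "\<forall>\<^sub>F r in at_left 1. (\<Sum>n<N. t n * r ^ (n + 1)) \<le> B"
      using eventually_at_left_real[of 0 1] by (auto elim!: eventually_mono)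
  qed simp
  show "summable t" using t partial by (rule summableI_nonneg_bounded)
  then show "suminf t \<le> B" using partial by (intro suminf_le_const)
qed

theorem theorem4:
  fixes f :: "complex \<Rightarrow> complex" and b :: "nat \<Rightarrow> real"
  assumes "f \<in> class_A"
    and "\<And>z. z \<in> ball 0 1 - {0} \<Longrightarrow> f z \<noteq> 0"
    and "\<And>z. z \<in> ball 0 1 - {0} \<Longrightarrow>
           (\<lambda>n. complex_of_real (b (n + 1)) * z ^ (n + 1)) sums (z / f z - 1)"
    and "\<And>n. n \<ge> 1 \<Longrightarrow> b n \<ge> 0"
  shows "f \<in> starlike_of_order (1/2) \<longleftrightarrow>
    summable (\<lambda>n. (2 * real (n + 1) - 1) * b (n + 1)) \<and>
    (\<Sum>n. (2 * real (n + 1) - 1) * b (n + 1)) \<le> 1"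
proof
  assume star: "f \<in> starlike_of_order (1/2)"
  have b0: "b (n + 1) \<ge> 0" for n using assms(4) by simp
  have t0: "(2 * real (n + 1) - 1) * b (n + 1) \<ge> 0" for n using b0[of n] by simp
  have "summable (\<lambda>n. (2 * real (n + 1) - 1) * b (n + 1) * r ^ (n + 1)) \<and>
      (\<Sum>n. (2 * real (n + 1) - 1) * b (n + 1) * r ^ (n + 1)) < 1" if r: "0 < r" "r < 1" for r
  proof -
    have z: "complex_of_real r \<in> ball 0 1 - {0}" using r by simp
    obtain W where W: "(\<lambda>n. of_nat (n + 1) * of_real (b (n + 1)) * complex_of_real r ^ (n + 1)) sums W"
      and eq: "of_real r * deriv f (of_real r) / f (of_real r) = 1 - W / (of_real r / f (of_real r))"
      using log_derivative_id_over_power_series[OF assms(2,3) z] .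
    have "Re (of_real r * deriv f (of_real r) / f (of_real r)) > 1/2"
      using star z by (simp only: starlike_of_order_def mem_Collect_eq)
    then have "Re (1 - W / (1 + (of_real r / f (of_real r) - 1))) > 1/2"
      by (simp add: eq)
    with Re_gt_half_imp_real_series_less_1[where a = "\<lambda>n. b (n + 1)", OF b0 _ assms(3)[OF z] W] r
    show ?thesis by simp
  qed
  then show "summable (\<lambda>n. (2 * real (n + 1) - 1) * b (n + 1)) \<and>
      (\<Sum>n. (2 * real (n + 1) - 1) * b (n + 1)) \<le> 1"
    using power_series_bounded_near_1_imp_summable[of "\<lambda>n. (2 * real (n + 1) - 1) * b (n + 1)" 1, OF t0]
    by (meson less_imp_le)
next
  assume R: "summable (\<lambda>n. (2 * real (n + 1) - 1) * b (n + 1)) \<and>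
    (\<Sum>n. (2 * real (n + 1) - 1) * b (n + 1)) \<le> 1"
  have b0: "b (n + 1) \<ge> 0" for n using assms(4) by simp
  have "Re (z * deriv f z / f z) > 1/2" if z: "z \<in> ball 0 1 - {0}" for z
  proof -
    obtain W where W: "(\<lambda>n. of_nat (n + 1) * of_real (b (n + 1)) * z ^ (n + 1)) sums W"
      and eq: "z * deriv f z / f z = 1 - W / (z / f z)"
      using log_derivative_id_over_power_series[OF assms(2,3) z] .
    have "1 + (z / f z - 1) \<noteq> 0" using assms(2)[OF z] z by simp
    then have "Re (1 - W / (1 + (z / f z - 1))) > 1/2"
      using coefficient_bound_imp_Re_gt_half[where a = "\<lambda>n. b (n + 1)", OF b0 _ _ assms(3)[OF z] W] R z
      by simp
    then show ?thesis by (simp add: eq)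
  qed
  then show "f \<in> starlike_of_order (1/2)"
    using assms(1,2) by (simp add: starlike_of_order_def)
qed

end
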